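(* Let $n\ge1$, let $g\in\ell^2(\mathbb{Z}^n)$ be a non-zero window function and let $f\in\ell^2(\mathbb{Z}^n)$ with $f\neq0$. Then $$E_k(|V_gf|^2)\ge-2\ln\left(\|f\|_{\ell^2(\mathbb{Z}^n)}\,\|g\|_{\ell^2(\mathbb{Z}^n)}\right)\|f\|_{\ell^2(\mathbb{Z}^n)}^2\,\|g\|_{\ell^2(\mathbb{Z}^n)}^2.$$
   Context: For $f,g\in\ell^2(\mathbb{Z}^n)$ the short-time Fourier transform (STFT) of $f$ with window $g$ is the function on $\mathbb{Z}^n\times\mathbb{T}^n$ (where $\mathbb{T}^n=\mathbb{R}^n/\mathbb{Z}^n$) given by $V_gf(m,w)=\sum_{k\in\mathbb{Z}^n}f(k)\,\overline{g(k-m)}\,e^{-2\pi i w\cdot k}$. For a non-negative measurable function $\rho$ on $\mathbb{Z}^n\times\mathbb{T}^n$, the $k$-entropy (the letter $k$ is just part of the name) is $$E_k(\rho)=-\sum_{m\in\mathbb{Z}^n}\int_{\mathbb{T}^n}\ln(\rho(m,w))\,\rho(m,w)\,d\mu(w)$$ whenever the right-hand side is well defined, with the convention $0\ln0=0$ and the value $+\infty$ allowed; $\mu$ is the Lebesgue measure on $\mathbb{T}^n$ (total mass $1$). *)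

theory Defs
  imports "HOL-Analysis.Analysis"
begin

definition l2 :: "('a \<Rightarrow> complex) set" where
  "l2 = {f. (\<lambda>k. (cmod (f k))\<^sup>2) summable_on UNIV}"

definition l2_norm :: "('a \<Rightarrow> complex) \<Rightarrow> real" where
  "l2_norm f = sqrt (\<Sum>\<^sub>\<infinity>k. (cmod (f k))\<^sup>2)"

text \<open>The torus \<open>\<real>\<^sup>n / \<int>\<^sup>n\<close> is represented by its fundamental domain \<open>[0,1)\<^sup>n\<close>; functions
  on the torus are given on all of \<open>\<real>\<^sup>n\<close> but only their values on this cube matter.\<close>

definition torus :: "(real ^ 'n) measure" where
  "torus = lebesgue_on {w. \<forall>i. 0 \<le> w $ i \<and> w $ i < 1}"

definition freq_dot :: "real ^ 'n \<Rightarrow> int ^ 'n \<Rightarrow> real" where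
  "freq_dot w k = (\<Sum>i\<in>UNIV. w $ i * real_of_int (k $ i))"

definition stft ::
  "(int ^ 'n \<Rightarrow> complex) \<Rightarrow> (int ^ 'n \<Rightarrow> complex) \<Rightarrow> (int ^ 'n) \<times> (real ^ 'n) \<Rightarrow> complex" where
  "stft g f = (\<lambda>(m, w). \<Sum>\<^sub>\<infinity>k. f k * cnj (g (k - m)) *
     exp (- 2 * complex_of_real pi * \<i> * complex_of_real (freq_dot w k)))"

text \<open>The entropy integrand \<open>- \<rho> ln \<rho>\<close> may be of either sign, so its integral is the difference of
  the integrals of its positive and negative parts. The function \<open>ennreal\<close> sends negative reals
  to 0 and hence extracts the positive part. Since \<open>ln 0 = 0\<close>, the convention \<open>0 ln 0 = 0\<close> holds.\<close>

definition k_entropy_pos :: "((int ^ 'n) \<times> (real ^ 'n) \<Rightarrow> real) \<Rightarrow> ennreal" where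
  "k_entropy_pos \<rho> = (\<Sum>\<^sub>\<infinity>m. \<integral>\<^sup>+w. ennreal (- (ln (\<rho> (m, w)) * \<rho> (m, w))) \<partial>torus)"

definition k_entropy_neg :: "((int ^ 'n) \<times> (real ^ 'n) \<Rightarrow> real) \<Rightarrow> ennreal" where
  "k_entropy_neg \<rho> = (\<Sum>\<^sub>\<infinity>m. \<integral>\<^sup>+w. ennreal (ln (\<rho> (m, w)) * \<rho> (m, w)) \<partial>torus)"

text \<open>Well-definedness, allowing the value \<open>+\<infinity>\<close> but not \<open>-\<infinity>\<close>. This has to be stated separately,
  because in \<^typ>\<open>ereal\<close> the undefined difference \<open>\<infinity> - \<infinity>\<close> evaluates to \<open>\<infinity>\<close>.\<close>

definition k_entropy_defined :: "((int ^ 'n) \<times> (real ^ 'n) \<Rightarrow> real) \<Rightarrow> bool" where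
  "k_entropy_defined \<rho> \<longleftrightarrow>
     (\<forall>x. 0 \<le> \<rho> x) \<and> \<rho> \<in> borel_measurable (count_space UNIV \<Otimes>\<^sub>M torus) \<and>
     k_entropy_neg \<rho> < \<infinity>"

definition k_entropy :: "((int ^ 'n) \<times> (real ^ 'n) \<Rightarrow> real) \<Rightarrow> ereal" where
  "k_entropy \<rho> = enn2ereal (k_entropy_pos \<rho>) - enn2ereal (k_entropy_neg \<rho>)"

end

theory Submission
  imports Defs
begin

text \<open>By Cauchy--Schwarz, \<open>\<rho> = \<bar>V\<^sub>g f\<bar>\<^sup>2\<close> is bounded by \<open>B = \<parallel>f\<parallel>\<^sup>2 \<parallel>g\<parallel>\<^sup>2\<close>, hence
  \<open>- \<rho> ln \<rho> \<ge> - ln B \<cdot> \<rho>\<close> pointwise. The total mass of \<open>\<rho>\<close> is exactly \<open>B\<close> (Moyal's identity):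
  \<open>k \<mapsto> f k \<cdot> cnj (g (k - m))\<close> is absolutely summable, so Parseval for each fixed \<open>m\<close> reduces to
  trigonometric polynomials by dominated convergence, and summing over \<open>m\<close> is a shift of indices.
  Equality of the mass (not just \<open>\<le>\<close>) matters because \<open>ln B\<close> may have either sign.\<close>

section \<open>Shifted products of square-summable functions\<close>

lemma l2_norm_sq: "(l2_norm f)\<^sup>2 = (\<Sum>\<^sub>\<infinity>k. (cmod (f k))\<^sup>2)"
  by (simp add: l2_norm_def infsum_nonneg)

lemma l2_norm_nonneg: "0 \<le> l2_norm f"
  by (simp add: l2_norm_def infsum_nonneg)

lemma l2_norm_pos:
  assumes "f \<in> l2" "f \<noteq> (\<lambda>_. 0)"
  shows "0 < l2_norm f"
proof -
  obtain a where a: "f a \<noteq> 0" using assms(2) by auto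
  have "sum (\<lambda>k. (cmod (f k))\<^sup>2) {a} \<le> (\<Sum>\<^sub>\<infinity>k. (cmod (f k))\<^sup>2)"
    by (rule finite_sum_le_infsum) (use assms(1) in \<open>auto simp: l2_def\<close>)
  with a have "0 < (\<Sum>\<^sub>\<infinity>k. (cmod (f k))\<^sup>2)"
    by (smt (verit) finite.emptyI insert_absorb insert_not_empty norm_eq_zero sum.empty sum.insert
        zero_less_power2)
  then show ?thesis by (simp add: l2_norm_def)
qed

lemma L2_set_le_l2_norm:
  assumes "f \<in> l2" "inj_on h S" "finite S"
  shows "L2_set (\<lambda>k. cmod (f (h k))) S \<le> l2_norm f"
proof -
  have "(\<Sum>k\<in>S. (cmod (f (h k)))\<^sup>2) = (\<Sum>k\<in>h ` S. (cmod (f k))\<^sup>2)"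
    using assms(2) by (simp add: sum.reindex)
  also have "\<dots> \<le> (\<Sum>\<^sub>\<infinity>k. (cmod (f k))\<^sup>2)"
    by (rule finite_sum_le_infsum) (use assms in \<open>auto simp: l2_def\<close>)
  finally show ?thesis by (simp add: L2_set_def l2_norm_def)
qed

text \<open>Cauchy-Schwarz on a finite set. The bound depends neither on \<open>S\<close> nor on
  \<open>m\<close>, so it gives absolute summability of the coefficients and a bound for their
  infinite sum.\<close>

lemma l2_shift_sum_le:
  fixes f g :: "'a::ab_group_add \<Rightarrow> complex"
  assumes "f \<in> l2" "g \<in> l2" "finite S"
  shows "(\<Sum>k\<in>S. cmod (f k * cnj (g (k - m)))) \<le> l2_norm f * l2_norm g"
proof -
  have "(\<Sum>k\<in>S. cmod (f k * cnj (g (k - m)))) = (\<Sum>k\<in>S. \<bar>cmod (f k)\<bar> * \<bar>cmod (g (k - m))\<bar>)"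
    by (simp add: norm_mult)
  also have "\<dots> \<le> L2_set (\<lambda>k. cmod (f k)) S * L2_set (\<lambda>k. cmod (g (k - m))) S"
    by (rule L2_set_mult_ineq)
  also have "\<dots> \<le> l2_norm f * l2_norm g"
    using L2_set_le_l2_norm[OF assms(1), of id S] L2_set_le_l2_norm[OF assms(2), of "\<lambda>k. k - m" S]
      assms(3)
    by (intro mult_mono) (auto simp: l2_norm_nonneg inj_on_def)
  finally show ?thesis .
qed

lemma l2_shift_abs_summable:
  fixes f g :: "'a::ab_group_add \<Rightarrow> complex"
  assumes "f \<in> l2" "g \<in> l2"
  shows "(\<lambda>k. cmod (f k * cnj (g (k - m)))) summable_on UNIV"
  by (rule nonneg_bdd_above_summable_on)
     (use l2_shift_sum_le[OF assms] in \<open>auto intro!: bdd_aboveI2\<close>)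

lemma l2_shift_infsum_le:
  fixes f g :: "'a::ab_group_add \<Rightarrow> complex"
  assumes "f \<in> l2" "g \<in> l2"
  shows "(\<Sum>\<^sub>\<infinity>k. cmod (f k * cnj (g (k - m)))) \<le> l2_norm f * l2_norm g"
  by (rule infsum_le_finite_sums[OF l2_shift_abs_summable[OF assms]])
     (use l2_shift_sum_le[OF assms] in auto)

text \<open>The double family over \<open>(k, j)\<close> is a product of two nonnegative summable
  families, so its sum is the product of the squared norms. Putting j = k - m and summing over
  \<open>k\<close> first leaves the energies for each fixed \<open>m\<close>.\<close>

lemma l2_shift_energy:
  fixes f g :: "'a::ab_group_add \<Rightarrow> complex"
  assumes "f \<in> l2" "g \<in> l2"
  shows "((\<lambda>m. \<Sum>\<^sub>\<infinity>k. (cmod (f k * cnj (g (k - m))))\<^sup>2) has_sum (l2_norm f * l2_norm g)\<^sup>2) UNIV"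
proof -
  have "((\<lambda>(k, j). (cmod (f k))\<^sup>2 * (cmod (g j))\<^sup>2) has_sum
          (l2_norm f)\<^sup>2 * (l2_norm g)\<^sup>2) (UNIV \<times> UNIV)"
  proof (rule has_sum_SigmaI)
    fix k :: 'a
    show "((\<lambda>j. (case (k, j) of (k, j) \<Rightarrow> (cmod (f k))\<^sup>2 * (cmod (g j))\<^sup>2)) has_sum
        (cmod (f k))\<^sup>2 * (l2_norm g)\<^sup>2) UNIV"
      using assms(2) by (auto simp: l2_norm_sq l2_def intro!: has_sum_cmult_right has_sum_infsum)
  next
    show "((\<lambda>k. (cmod (f k))\<^sup>2 * (l2_norm g)\<^sup>2) has_sum (l2_norm f)\<^sup>2 * (l2_norm g)\<^sup>2) UNIV"
      unfolding l2_norm_sq[of f]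
      using assms(1) by (auto simp: l2_def intro!: has_sum_cmult_left has_sum_infsum)
  next
    show "(\<lambda>(k, j). (cmod (f k))\<^sup>2 * (cmod (g j))\<^sup>2) summable_on (UNIV \<times> (UNIV :: 'a set))"
      by (rule summable_on_SigmaI[where g = "\<lambda>k. (cmod (f k))\<^sup>2 * (l2_norm g)\<^sup>2"])
         (use assms in \<open>auto simp: l2_norm_sq l2_def
            intro!: has_sum_cmult_right has_sum_infsum summable_on_cmult_left\<close>)
  qed
  \<comment> \<open>The map \<open>(m, k)\<close> to \<open>(k, k - m)\<close> is a bijection with
    inverse \<open>(k, j)\<close> to \<open>(k - j, k)\<close>, so nothing is lost or counted
    twice.\<close>
  then have *: "((\<lambda>(m, k). (cmod (f k * cnj (g (k - m))))\<^sup>2) has_sum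
      (l2_norm f)\<^sup>2 * (l2_norm g)\<^sup>2) (UNIV \<times> UNIV)"
    by (subst has_sum_reindex_bij_witness[where i = "\<lambda>(k, j). (k - j, k)" and j = "\<lambda>(m, k). (k, k - m)"
          and T = "UNIV \<times> UNIV" and h = "\<lambda>(k, j). (cmod (f k))\<^sup>2 * (cmod (g j))\<^sup>2"])
       (auto simp: norm_mult power_mult_distrib)
  have "((\<lambda>m. \<Sum>\<^sub>\<infinity>k. (cmod (f k * cnj (g (k - m))))\<^sup>2) has_sum
      (l2_norm f)\<^sup>2 * (l2_norm g)\<^sup>2) UNIV"
  proof (rule has_sum_SigmaD[OF *])
    fix m :: 'a
    have "(\<lambda>p. case p of (m, k) \<Rightarrow> (cmod (f k * cnj (g (k - m))))\<^sup>2) summable_on UNIV \<times> UNIV"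
      using * by (rule has_sum_imp_summable)
    then have "(\<lambda>k. (cmod (f k * cnj (g (k - m))))\<^sup>2) summable_on UNIV"
      using summable_on_SigmaD1 by fastforce
    then show "((\<lambda>k. case (m, k) of (m, k) \<Rightarrow> (cmod (f k * cnj (g (k - m))))\<^sup>2) has_sum
        (\<Sum>\<^sub>\<infinity>k. (cmod (f k * cnj (g (k - m))))\<^sup>2)) UNIV"
      by simp
  qed
  then show ?thesis by (simp add: power_mult_distrib)
qed

section \<open>Orthogonality of the characters of the torus\<close>

abbreviation fundamental_cube :: "(real ^ 'n) set" where
  "fundamental_cube \<equiv> {w. \<forall>i. 0 \<le> w $ i \<and> w $ i < 1}"

definition torus_char :: "int ^ 'n \<Rightarrow> real ^ 'n \<Rightarrow> complex" where
  "torus_char k w = exp (- 2 * complex_of_real pi * \<i> * complex_of_real (freq_dot w k))"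

lemma cmod_torus_char [simp]: "cmod (torus_char k w) = 1"
  by (simp add: torus_char_def)

lemma torus_char_0: "torus_char 0 = (\<lambda>_. 1)"
  by (simp add: torus_char_def freq_dot_def fun_eq_iff)

lemma torus_char_mult_cnj: "torus_char k w * cnj (torus_char l w) = torus_char (k - l) w"
  by (simp add: torus_char_def freq_dot_def exp_cnj exp_add[symmetric] algebra_simps sum_subtractf)

lemma borel_measurable_fundamental_cube: "fundamental_cube \<in> sets (borel :: (real ^ 'n) measure)"
  by measurable

lemma borel_measurable_torus_char: "torus_char k \<in> borel_measurable borel"
  unfolding torus_char_def freq_dot_def
  by (intro borel_measurable_continuous_onI continuous_intros)

lemma borel_measurable_torus_char_torus [measurable]: "torus_char k \<in> borel_measurable torus"
  unfolding torus_def
  by (intro measurable_restrict_space1 measurable_completion)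
     (simp add: borel_measurable_torus_char)

text \<open>The one-dimensional factor of a character. For nonzero \<open>j\<close> its
  antiderivative takes equal values at 0 and 1 by periodicity; for \<open>j = 0\<close> the
  integrand is 1.\<close>

lemma integral_exp_unit_interval:
  fixes j :: int
  defines "F \<equiv> \<lambda>t::real. indicator {0..<1} t *\<^sub>R
    exp (- 2 * complex_of_real pi * \<i> * complex_of_real (t * real_of_int j))"
  shows "integrable lborel F" "integral\<^sup>L lborel F = of_bool (j = 0)"
proof -
  define c where "c = - 2 * complex_of_real pi * \<i> * of_int j"
  define e where "e = (\<lambda>t::real. exp (c * complex_of_real t))"
  have F: "F = (\<lambda>t. indicator {0..<1} t *\<^sub>R e t)"
    by (auto simp: F_def e_def c_def mult_ac fun_eq_iff)
  have e_meas [measurable]: "e \<in> borel_measurable borel"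
    unfolding e_def by (intro borel_measurable_continuous_onI continuous_intros)
  show "integrable lborel F"
    unfolding F
    by (rule integrableI_bounded_set_indicator[where B = 1])
       (auto simp: e_def c_def)
  \<comment> \<open>Adding the endpoint 1 changes the integrand on a null set only, and the
    fundamental theorem of calculus applies on the closed interval.\<close>
  have "integral\<^sup>L lborel F = (LINT t|lborel. indicator {0..1} t *\<^sub>R e t)"
    unfolding F
    by (rule integral_cong_AE) (use AE_lborel_singleton[of "1::real"] in \<open>auto split: split_indicator\<close>)
  also have "\<dots> = of_bool (j = 0)"
  proof (cases "j = 0")
    case True
    then show ?thesis by (simp add: e_def c_def)
  next
    case False
    then have c: "c \<noteq> 0" by (simp add: c_def)
    have "(LINT t|lborel. indicator {0..1} t *\<^sub>R e t) = e 1 / c - e 0 / c"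
    proof (rule integral_FTC_atLeastAtMost)
      show "continuous_on {0..1} e" unfolding e_def by (intro continuous_intros)
      fix x :: real
      show "((\<lambda>x. e x / c) has_vector_derivative e x) (at x within {0..1})"
        unfolding e_def using c
        by (auto intro!: derivative_eq_intros has_vector_derivative_real_field)
    qed simp
    also have "e 1 = 1"
      using exp_integer_2pi[of "of_int (- j)"] by (simp add: e_def c_def mult_ac)
    finally show ?thesis using False by (simp add: e_def)
  qed
  finally show "integral\<^sup>L lborel F = of_bool (j = 0)" .
qed

text \<open>Both the indicator of the cube and the character are products of functions of one
  coordinate each, so Fubini reduces the integral to the one-dimensional case.\<close>

lemma integral_fundamental_cube_torus_char:
  fixes k :: "int ^ 'n"
  shows "(LINT w|lborel. indicator fundamental_cube w *\<^sub>R torus_char k w) = of_bool (k = 0)"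
proof -
  \<comment> \<open>\<open>lborel\<close> is the image of a product measure indexed by
    \<open>Basis\<close>, not by \<open>'n\<close>; \<open>axis_index\<close> recovers the
    coordinate that belongs to a basis vector.\<close>
  define G where "G = (\<lambda>(b :: real ^ 'n) t. indicator {0..<1::real} t *\<^sub>R
    exp (- 2 * complex_of_real pi * \<i> * complex_of_real (t * real_of_int (k $ axis_index b))))"
  have Basis: "(Basis :: (real ^ 'n) set) = (\<lambda>i. axis i 1) ` UNIV"
    by (auto simp: Basis_vec_def)
  have inj: "inj (\<lambda>i::'n. axis i (1::real))"
    by (auto simp: inj_def axis_eq_axis)
  have prod: "indicator fundamental_cube w *\<^sub>R torus_char k w = (\<Prod>b\<in>Basis. G b (w \<bullet> b))" for w
  proof -
    have "(\<Prod>b\<in>Basis. G b (w \<bullet> b)) = (\<Prod>i\<in>UNIV. G (axis i 1) (w $ i))"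
      unfolding Basis by (subst prod.reindex[OF inj]) (simp add: inner_axis)
    also have "\<dots> = (\<Prod>i\<in>UNIV. of_real (indicator {0..<1} (w $ i))) *
        (\<Prod>i\<in>UNIV. exp (- 2 * complex_of_real pi * \<i> * complex_of_real (w $ i * real_of_int (k $ i))))"
      by (simp add: G_def scaleR_conv_of_real prod.distrib)
    also have "(\<Prod>i\<in>UNIV. complex_of_real (indicator {0..<1} (w $ i))) = of_real (indicator fundamental_cube w)"
      by (auto simp: indicator_def)
    also have "(\<Prod>i\<in>UNIV. exp (- 2 * complex_of_real pi * \<i> *
        complex_of_real (w $ i * real_of_int (k $ i)))) = torus_char k w"
      by (simp add: torus_char_def freq_dot_def exp_sum[symmetric] sum_distrib_left)
    finally show ?thesis by (simp add: scaleR_conv_of_real)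
  qed
  interpret product_sigma_finite "\<lambda>_ :: real ^ 'n. lborel :: real measure" ..
  have "(LINT w|lborel. indicator fundamental_cube w *\<^sub>R torus_char k w) =
      (LINT x|(\<Pi>\<^sub>M b\<in>(Basis :: (real ^ 'n) set). lborel).
        (indicator fundamental_cube (\<Sum>b\<in>Basis. x b *\<^sub>R b) *\<^sub>R torus_char k (\<Sum>b\<in>Basis. x b *\<^sub>R b)))"
    by (subst lborel_eq, subst integral_distr)
       (auto intro!: borel_measurable_scaleR borel_measurable_indicator
          borel_measurable_fundamental_cube borel_measurable_torus_char)
  also have "\<dots> = (LINT x|(\<Pi>\<^sub>M b\<in>Basis. lborel). (\<Prod>b\<in>Basis. G b (x b)))"
    unfolding prod by (simp add: inner_sum_left inner_Basis if_distrib cong: if_cong prod.cong)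
  also have "\<dots> = (\<Prod>b\<in>Basis. integral\<^sup>L lborel (G b))"
    unfolding G_def by (intro product_integral_prod integral_exp_unit_interval(1)) simp
  also have "\<dots> = (\<Prod>b\<in>(Basis :: (real ^ 'n) set). of_bool (k $ axis_index b = 0))"
    unfolding G_def integral_exp_unit_interval ..
  also have "\<dots> = (\<Prod>i\<in>UNIV. of_bool (k $ i = 0))"
    unfolding Basis by (subst prod.reindex[OF inj]) simp
  also have "\<dots> = of_bool (k = 0)"
    by (auto simp: vec_eq_iff)
  finally show ?thesis .
qed

lemma integral_torus_char: "integral\<^sup>L torus (torus_char k) = of_bool (k = 0)"
proof -
  have "integral\<^sup>L torus (torus_char k) =
      (LINT w|lebesgue. indicator fundamental_cube w *\<^sub>R torus_char k w)"
    unfolding torus_def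
    by (subst integral_restrict_space) (use borel_measurable_fundamental_cube in auto)
  \<comment> \<open>The integrand is Borel measurable, so completing the measure does not change its
    integral.\<close>
  also have "\<dots> = (LINT w|lborel. indicator fundamental_cube w *\<^sub>R torus_char k w)"
    by (intro integral_completion)
       (auto intro!: borel_measurable_scaleR borel_measurable_indicator
          borel_measurable_fundamental_cube borel_measurable_torus_char)
  finally show ?thesis by (simp add: integral_fundamental_cube_torus_char)
qed

lemma finite_measure_torus: "finite_measure (torus :: (real ^ 'n) measure)"
proof
  have "integral\<^sup>L torus (torus_char (0 :: int ^ 'n)) =
      of_real (measure torus (space (torus :: (real ^ 'n) measure)))"
    by (simp add: torus_char_0 scaleR_conv_of_real)
  then have "measure torus (space (torus :: (real ^ 'n) measure)) = 1"
    by (simp add: integral_torus_char)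
  \<comment> \<open>If \<open>emeasure\<close> were infinite, \<open>measure\<close> would have the
    default value 0, not 1.\<close>
  then show "emeasure torus (space (torus :: (real ^ 'n) measure)) \<noteq> \<infinity>"
    by (auto simp: measure_def)
qed

lemma integrable_torus_char: "integrable torus (torus_char k)"
proof -
  interpret finite_measure torus by (rule finite_measure_torus)
  show ?thesis by (rule integrable_const_bound[where B = 1]) auto
qed


section \<open>Parseval's identity for absolutely summable coefficients\<close>

lemma parseval_trig_polynomial:
  fixes h :: "int ^ 'n \<Rightarrow> complex"
  assumes "finite S"
  shows "(LINT w|torus. (cmod (\<Sum>k\<in>S. h k * torus_char k w))\<^sup>2) = (\<Sum>k\<in>S. (cmod (h k))\<^sup>2)"
proof -
  \<comment> \<open>In the complex numbers the square of the modulus is z times its conjugate, which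
    expands into a double sum of characters; orthogonality keeps its diagonal.\<close>
  have "complex_of_real (LINT w|torus. (cmod (\<Sum>k\<in>S. h k * torus_char k w))\<^sup>2) =
      (LINT w|torus. complex_of_real ((cmod (\<Sum>k\<in>S. h k * torus_char k w))\<^sup>2))"
    by (rule integral_complex_of_real[symmetric])
  also have "\<dots> = (LINT w|torus. (\<Sum>k\<in>S. \<Sum>l\<in>S. h k * cnj (h l) * torus_char (k - l) w))"
    unfolding complex_norm_square torus_char_mult_cnj[symmetric]
    by (simp add: sum_product mult_ac)
  also have "\<dots> = (\<Sum>k\<in>S. \<Sum>l\<in>S. h k * cnj (h l) * of_bool (k = l))"
    by (simp add: integral_torus_char integrable_torus_char)
  also have "\<dots> = complex_of_real (\<Sum>k\<in>S. (cmod (h k))\<^sup>2)"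
    using assms by (simp add: of_bool_def if_distrib complex_norm_square[symmetric] cong: if_cong)
  finally show ?thesis by (simp only: of_real_eq_iff)
qed

text \<open>Measurability of limits and dominated convergence work along sequences, so the unordered
  sums over the lattice have to be enumerated. Constant vectors show that the lattice is
  infinite.\<close>

lemma bij_nat_int_vec: obtains e :: "nat \<Rightarrow> int ^ 'n" where "bij e"
proof -
  have "inj (\<lambda>j::int. (\<chi> i. j) :: int ^ 'n)"
    by (auto simp: inj_def vec_eq_iff)
  then have "infinite (UNIV :: (int ^ 'n) set)"
    using finite_subset[of "range (\<lambda>j::int. (\<chi> i. j) :: int ^ 'n)" UNIV]
      finite_imageD infinite_UNIV_int by blast
  then show ?thesis
    using that[OF bij_betw_from_nat_into[of "UNIV :: (int ^ 'n) set"]] by auto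
qed

text \<open>The partial sums converge at every point and are all bounded by the sum \<open>C\<close>
  of the moduli of the coefficients. A constant is integrable on the torus, so Parseval passes to
  the limit.\<close>

lemma torus_char_series:
  fixes h :: "int ^ 'n \<Rightarrow> complex"
  assumes h: "(\<lambda>k. cmod (h k)) summable_on UNIV"
  defines "V \<equiv> \<lambda>w. \<Sum>\<^sub>\<infinity>k. h k * torus_char k w"
  shows borel_measurable_torus_char_series: "V \<in> borel_measurable torus"
    and parseval_torus_char_series:
      "((\<lambda>k. (cmod (h k))\<^sup>2) has_sum (LINT w|torus. (cmod (V w))\<^sup>2)) UNIV"
proof -
  obtain e :: "nat \<Rightarrow> int ^ 'n" where e: "bij e" by (rule bij_nat_int_vec)
  then have inj_e: "inj_on e A" for A
    by (meson bij_is_inj inj_on_subset subset_UNIV)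
  define F where "F = (\<lambda>N w. \<Sum>k\<in>e ` {..<N}. h k * torus_char k w)"
  define C where "C = (\<Sum>\<^sub>\<infinity>k. cmod (h k))"
  have F_meas [measurable]: "F N \<in> borel_measurable torus" for N
    unfolding F_def by measurable
  have tendsto: "(\<lambda>N. F N w) \<longlonglongrightarrow> V w" for w
  proof -
    have "(\<lambda>k. h k * torus_char k w) summable_on UNIV"
      by (rule abs_summable_summable) (use h in \<open>simp add: norm_mult\<close>)
    then have "((\<lambda>k. h k * torus_char k w) has_sum V w) UNIV"
      unfolding V_def by (rule has_sum_infsum)
    then have "((\<lambda>n. h (e n) * torus_char (e n) w) has_sum V w) UNIV"
      by (subst has_sum_reindex_bij_betw[OF e, of "\<lambda>k. h k * torus_char k w"])
    from has_sum_imp_sums[OF this] show ?thesis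
      by (simp add: sums_def F_def sum.reindex[OF inj_e])
  qed
  show V_meas [measurable]: "V \<in> borel_measurable torus"
    by (rule borel_measurable_LIMSEQ_metric[OF F_meas tendsto])
  have F_le: "cmod (F N w) \<le> C" for N w
  proof -
    have "cmod (F N w) \<le> (\<Sum>k\<in>e ` {..<N}. cmod (h k))"
      unfolding F_def by (rule order.trans[OF norm_sum]) (simp add: norm_mult)
    also have "\<dots> \<le> C"
      unfolding C_def by (rule finite_sum_le_infsum[OF h]) auto
    finally show ?thesis .
  qed
  interpret finite_measure "torus :: (real ^ 'n) measure" by (rule finite_measure_torus)
  have "(\<lambda>N. LINT w|torus. (cmod (F N w))\<^sup>2) \<longlonglongrightarrow> (LINT w|torus. (cmod (V w))\<^sup>2)"
    by (rule integral_dominated_convergence[where w = "\<lambda>_. C\<^sup>2"])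
       (auto intro!: tendsto_power tendsto_norm tendsto power_mono F_le)
  then have "(\<lambda>n. (cmod (h (e n)))\<^sup>2) sums (LINT w|torus. (cmod (V w))\<^sup>2)"
    by (simp add: F_def parseval_trig_polynomial) (simp add: sum.reindex[OF inj_e] sums_def)
  \<comment> \<open>Since the terms are nonnegative, convergence in the order of \<open>e\<close>
    already gives unordered summability.\<close>
  then have "((\<lambda>n. (cmod (h (e n)))\<^sup>2) has_sum (LINT w|torus. (cmod (V w))\<^sup>2)) UNIV"
    by (rule sums_nonneg_imp_has_sum) simp
  then show "((\<lambda>k. (cmod (h k))\<^sup>2) has_sum (LINT w|torus. (cmod (V w))\<^sup>2)) UNIV"
    using has_sum_reindex_bij_betw[OF e, of "\<lambda>k. (cmod (h k))\<^sup>2"] by blast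
qed

section \<open>Entropy of a bounded density of known mass\<close>

lemma ennreal_summable_on: "(f :: 'a \<Rightarrow> ennreal) summable_on A"
  by (simp add: nonneg_summable_on_complete)

text \<open>For nonnegative terms both sums are the supremum of the finite partial sums.\<close>

lemma infsum_ennreal_has_sum:
  fixes f :: "'a \<Rightarrow> real"
  assumes "(f has_sum S) A" "\<And>x. x \<in> A \<Longrightarrow> 0 \<le> f x"
  shows "(\<Sum>\<^sub>\<infinity>x\<in>A. ennreal (f x)) = ennreal S"
proof -
  have "(\<Sum>\<^sub>\<infinity>x\<in>A. ennreal (f x)) = (SUP F\<in>{F. finite F \<and> F \<subseteq> A}. \<Sum>x\<in>F. ennreal (f x))"
    by (rule nonneg_infsum_complete) simp
  also have "\<dots> = (SUP F\<in>{F. finite F \<and> F \<subseteq> A}. ennreal (sum f F))"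
    using assms(2) by (intro SUP_cong refl sum_ennreal) auto
  also have "\<dots> = ennreal (infsum f A)"
    using assms by (intro infsum_nonneg_is_SUPREMUM_ennreal[symmetric]) (auto simp: summable_on_def)
  finally show ?thesis using assms(1) by (simp add: infsumI)
qed

text \<open>The upper bound \<open>B\<close> controls the negative part of the entropy by a multiple
  of the mass \<open>S\<close>, so the entropy is defined; its positive part may still be
  infinite.\<close>

lemma k_entropy_ge_of_bounded:
  fixes \<rho> :: "(int ^ 'n) \<times> (real ^ 'n) \<Rightarrow> real"
  assumes nonneg: "\<And>x. 0 \<le> \<rho> x" and le: "\<And>x. \<rho> x \<le> B"
    and meas [measurable]: "\<And>m. (\<lambda>w. \<rho> (m, w)) \<in> borel_measurable torus"
    and mass: "((\<lambda>m. LINT w|torus. \<rho> (m, w)) has_sum S) UNIV"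
  shows "k_entropy_defined \<rho> \<and> ereal (- ln B * S) \<le> k_entropy \<rho>"
proof -
  interpret finite_measure "torus :: (real ^ 'n) measure" by (rule finite_measure_torus)
  \<comment> \<open>Positive and negative part of \<open>ln B\<close>: \<open>ennreal\<close> would
    truncate a negative factor to 0.\<close>
  define cp cn where "cp = max (ln B) 0" and "cn = max (- ln B) 0"
  have c: "0 \<le> cp" "0 \<le> cn" "cn - cp = - ln B"
    by (auto simp: cp_def cn_def)
  have S: "0 \<le> S"
    using mass by (rule has_sum_nonneg) (simp add: nonneg)
  \<comment> \<open>Where the density vanishes both sides are 0; elsewhere \<open>ln\<close> is
    monotone on positive reals.\<close>
  have ln_le: "ln (\<rho> x) * \<rho> x \<le> ln B * \<rho> x" for x
    using nonneg[of x] le[of x] by (cases "\<rho> x = 0") (auto intro!: mult_right_mono)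
  have total: "(\<Sum>\<^sub>\<infinity>m. \<integral>\<^sup>+w. ennreal (c * \<rho> (m, w)) \<partial>torus) = ennreal (c * S)" if "0 \<le> c" for c
  proof -
    have "integrable torus (\<lambda>w. \<rho> (m, w))" for m
      by (rule integrable_const_bound[where B = B]) (auto simp: nonneg le)
    then have "(\<integral>\<^sup>+w. ennreal (c * \<rho> (m, w)) \<partial>torus) = ennreal (c * (LINT w|torus. \<rho> (m, w)))" for m
      using that by (subst nn_integral_eq_integral) (auto simp: nonneg)
    then show ?thesis
      using that has_sum_cmult_right[OF mass, of c]
      by (simp add: infsum_ennreal_has_sum nonneg)
  qed
  have "ennreal (ln (\<rho> x) * \<rho> x) \<le> ennreal (cp * \<rho> x)" for x
    using ln_le[of x] nonneg[of x]
    by (intro ennreal_leI) (smt (verit) cp_def mult_right_mono)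
  then have "k_entropy_neg \<rho> \<le> ennreal (cp * S)"
    unfolding k_entropy_neg_def total[OF c(1), symmetric]
    by (intro infsum_mono nn_integral_mono ennreal_summable_on)
  then have neg: "k_entropy_neg \<rho> < \<infinity>"
    using le_less_trans by fastforce
  \<comment> \<open>Written without subtraction, since both sides of \<open>- \<rho> ln \<rho> \<ge> - ln B \<cdot> \<rho>\<close> are split into
    positive and negative parts and summed in \<^typ>\<open>ennreal\<close>.\<close>
  have pointwise: "ennreal (ln (\<rho> x) * \<rho> x) + ennreal (cn * \<rho> x) \<le>
      ennreal (- (ln (\<rho> x) * \<rho> x)) + ennreal (cp * \<rho> x)" for x
  proof -
    define p where "p = ln (\<rho> x) * \<rho> x"
    have "cn * \<rho> x - cp * \<rho> x = - (ln B * \<rho> x)"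
      using c(3) by (simp add: left_diff_distrib[symmetric])
    then have "max 0 p + cn * \<rho> x \<le> max 0 (- p) + cp * \<rho> x"
      using ln_le[of x] by (auto simp: p_def)
    then have "ennreal (max 0 p) + ennreal (cn * \<rho> x) \<le> ennreal (max 0 (- p)) + ennreal (cp * \<rho> x)"
      using c nonneg[of x] by (simp add: ennreal_plus[symmetric] ennreal_leI del: ennreal_plus)
    then show ?thesis by (simp add: p_def ennreal_max_0)
  qed
  have "k_entropy_neg \<rho> + ennreal (cn * S) =
      (\<Sum>\<^sub>\<infinity>m. \<integral>\<^sup>+w. ennreal (ln (\<rho> (m, w)) * \<rho> (m, w)) + ennreal (cn * \<rho> (m, w)) \<partial>torus)"
    unfolding k_entropy_neg_def total[OF c(2), symmetric]
    by (subst infsum_add[OF ennreal_summable_on ennreal_summable_on, symmetric])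
       (simp add: nn_integral_add)
  also have "\<dots> \<le> (\<Sum>\<^sub>\<infinity>m. \<integral>\<^sup>+w. ennreal (- (ln (\<rho> (m, w)) * \<rho> (m, w))) + ennreal (cp * \<rho> (m, w)) \<partial>torus)"
    by (intro infsum_mono nn_integral_mono pointwise ennreal_summable_on)
  also have "\<dots> = k_entropy_pos \<rho> + ennreal (cp * S)"
    unfolding k_entropy_pos_def total[OF c(1), symmetric]
    by (subst infsum_add[OF ennreal_summable_on ennreal_summable_on, symmetric])
       (simp add: nn_integral_add)
  finally have main: "k_entropy_neg \<rho> + ennreal (cn * S) \<le> k_entropy_pos \<rho> + ennreal (cp * S)" .
  have "ereal (- ln B * S) \<le> k_entropy \<rho>"
  \<comment> \<open>With both parts finite, \<open>main\<close> can be rearranged in the reals. If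
    the positive part is infinite, finiteness of the negative part makes the entropy
    infinite.\<close>
  proof (cases "k_entropy_pos \<rho>")
    case (real p)
    obtain q where q: "k_entropy_neg \<rho> = ennreal q" "0 \<le> q"
      using neg by (cases "k_entropy_neg \<rho>") auto
    have "q + cn * S \<le> p + cp * S"
      using main real q c S by (simp add: ennreal_plus[symmetric] del: ennreal_plus)
    then have "- ln B * S \<le> p - q"
      unfolding c(3)[symmetric] by (simp add: algebra_simps)
    then show ?thesis
      using real q by (simp add: k_entropy_def)
  next
    case top
    then show ?thesis
      using neg by (cases "k_entropy_neg \<rho>") (auto simp: k_entropy_def)
  qed
  \<comment> \<open>The lattice is countable, so joint measurability follows from that of each
    section.\<close>
  moreover have "\<rho> \<in> borel_measurable (count_space UNIV \<Otimes>\<^sub>M torus)"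
    by (rule measurable_pair_measure_countable1) auto
  ultimately show ?thesis
    using neg nonneg by (auto simp: k_entropy_defined_def)
qed

theorem theorem3p20:
  fixes f g :: "int ^ 'n \<Rightarrow> complex"
  assumes "g \<in> l2" and "g \<noteq> (\<lambda>_. 0)"
    and "f \<in> l2" and "f \<noteq> (\<lambda>_. 0)"
  shows "k_entropy_defined (\<lambda>x. (cmod (stft g f x))\<^sup>2) \<and>
    k_entropy (\<lambda>x. (cmod (stft g f x))\<^sup>2)
      \<ge> ereal (- 2 * ln (l2_norm f * l2_norm g) * (l2_norm f)\<^sup>2 * (l2_norm g)\<^sup>2)"
proof -
  define A where "A = l2_norm f * l2_norm g"
  \<comment> \<open>For fixed \<open>m\<close>, the transform is the Fourier series in
    \<open>w\<close> with coefficients \<open>h m\<close>.\<close>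
  define h where "h m k = f k * cnj (g (k - m))" for m k
  have A: "0 < A"
    using assms by (simp add: A_def l2_norm_pos)
  have stft: "stft g f (m, w) = (\<Sum>\<^sub>\<infinity>k. h m k * torus_char k w)" for m w
    by (simp add: stft_def h_def torus_char_def)
  have summable: "(\<lambda>k. cmod (h m k)) summable_on UNIV" for m
    unfolding h_def by (rule l2_shift_abs_summable) fact+
  have bound: "cmod (stft g f x) \<le> A" for x
  proof (cases x)
    case (Pair m w)
    have "cmod (stft g f x) \<le> (\<Sum>\<^sub>\<infinity>k. cmod (h m k * torus_char k w))"
      unfolding Pair stft by (rule norm_infsum_bound) (use summable in \<open>simp add: norm_mult\<close>)
    also have "\<dots> \<le> A"
      using l2_shift_infsum_le[OF assms(3,1), of m] by (simp add: norm_mult h_def A_def)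
    finally show ?thesis .
  qed
  have "(LINT w|torus. (cmod (stft g f (m, w)))\<^sup>2) = (\<Sum>\<^sub>\<infinity>k. (cmod (h m k))\<^sup>2)" for m
    unfolding stft by (rule infsumI[OF parseval_torus_char_series[OF summable], symmetric])
  then have mass: "((\<lambda>m. LINT w|torus. (cmod (stft g f (m, w)))\<^sup>2) has_sum A\<^sup>2) UNIV"
    using l2_shift_energy[OF assms(3,1)] by (simp only: h_def A_def)
  have "(\<lambda>w. stft g f (m, w)) \<in> borel_measurable torus" for m
    unfolding stft by (rule borel_measurable_torus_char_series[OF summable])
  \<comment> \<open>The pointwise bound and the total mass are the same number: both
    \<open>B\<close> and \<open>S\<close> are \<open>A\<^sup>2\<close>.\<close>
  then have "k_entropy_defined (\<lambda>x. (cmod (stft g f x))\<^sup>2) \<and>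
      ereal (- ln (A\<^sup>2) * A\<^sup>2) \<le> k_entropy (\<lambda>x. (cmod (stft g f x))\<^sup>2)"
    by (intro k_entropy_ge_of_bounded) (auto intro!: mass power_mono bound)
  \<comment> \<open>Both functions are non-zero, so \<open>A\<close> is positive and the logarithm
    of its square is 2 ln A.\<close>
  moreover have "- ln (A\<^sup>2) * A\<^sup>2 = - 2 * ln (l2_norm f * l2_norm g) * (l2_norm f)\<^sup>2 * (l2_norm g)\<^sup>2"
    using A by (simp add: ln_realpow) (simp add: A_def power_mult_distrib)
  ultimately show ?thesis by simp
qed

end
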